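(* There is an absolute constant $C \geq 1$ such that for every Lebesgue measurable set $K \subset \mathbb{R}^{3}$, $$|K| \leq C\, |\pi_{1}(K)|^{2/3} \cdot |\pi_{2}(K)|^{2/3}.$$
   Context: The first Heisenberg group $\mathbb{H}$ is $\mathbb{R}^{3}$ with the group product $(x,y,t)\cdot(x',y',t') = (x+x',y+y',t+t'+\tfrac12(xy'-yx'))$. The maps $\pi_{1},\pi_{2}$ are the vertical projections, whose fibres are the left translates of $\{(x,0,0) : x \in \mathbb{R}\}$ and $\{(0,y,0) : y \in \mathbb{R}\}$ respectively. Explicitly, $\pi_{1}(x,y,t) = (0,y,t+\tfrac{xy}{2})$, with values in the plane $\{(0,y,t) : y,t\in\mathbb{R}\} \cong \mathbb{R}^{2}$, and $\pi_{2}(x,y,t) = (x,0,t-\tfrac{xy}{2})$, with values in the plane $\{(x,0,t) : x,t \in \mathbb{R}\} \cong \mathbb{R}^{2}$. On the left, $|\cdot|$ is Lebesgue measure on $\mathbb{R}^{3}$; on the right, $|\cdot|$ is 2-dimensional Lebesgue (outer) measure on the respective plane identified with $\mathbb{R}^{2}$, with the convention $0\cdot\infty = 0$. *)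

theory Defs
  imports "HOL-Analysis.Analysis"
begin

text \<open>The first Heisenberg group: \<open>\<real>\<^sup>3\<close> with a non-commutative product.\<close>

type_synonym heis = "real \<times> real \<times> real"

definition heis_mult :: "heis \<Rightarrow> heis \<Rightarrow> heis"  (infixl "\<cdot>\<^sub>H" 70)
  where "p \<cdot>\<^sub>H q = (case p of (x, y, t) \<Rightarrow> case q of (x', y', t') \<Rightarrow>
           (x + x', y + y', t + t' + (x * y' - y * x') / 2))"

definition \<pi>\<^sub>1 :: "heis \<Rightarrow> heis"
  where "\<pi>\<^sub>1 p = (case p of (x, y, t) \<Rightarrow> (0, y, t + x * y / 2))"

definition \<pi>\<^sub>2 :: "heis \<Rightarrow> heis"
  where "\<pi>\<^sub>2 p = (case p of (x, y, t) \<Rightarrow> (x, 0, t - x * y / 2))"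

text \<open>The explicit formulas do give the vertical projections: the fibres are the left
  translates of the horizontal \<open>x\<close>- and \<open>y\<close>-axes.\<close>

lemma fibre_pi1: "{q. \<pi>\<^sub>1 q = \<pi>\<^sub>1 p} = (\<lambda>h. p \<cdot>\<^sub>H h) ` {(x, 0, 0) | x. True}"
proof -
  obtain a b c where p: "p = (a, b, c)"
    using prod_cases3 by blast
  have "q \<in> (\<lambda>h. p \<cdot>\<^sub>H h) ` {(x, 0, 0) | x. True}" if "\<pi>\<^sub>1 q = \<pi>\<^sub>1 p" for q
  proof -
    obtain x y t where q: "q = (x, y, t)"
      using prod_cases3 by blast
    have "q = p \<cdot>\<^sub>H (x - a, 0, 0)"
      using that by (auto simp: p q \<pi>\<^sub>1_def heis_mult_def field_simps)
    then show ?thesis by blast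
  qed
  then show ?thesis
    by (auto simp: p \<pi>\<^sub>1_def heis_mult_def field_simps)
qed

lemma fibre_pi2: "{q. \<pi>\<^sub>2 q = \<pi>\<^sub>2 p} = (\<lambda>h. p \<cdot>\<^sub>H h) ` {(0, y, 0) | y. True}"
proof -
  obtain a b c where p: "p = (a, b, c)"
    using prod_cases3 by blast
  have "q \<in> (\<lambda>h. p \<cdot>\<^sub>H h) ` {(0, y, 0) | y. True}" if "\<pi>\<^sub>2 q = \<pi>\<^sub>2 p" for q
  proof -
    obtain x y t where q: "q = (x, y, t)"
      using prod_cases3 by blast
    have "q = p \<cdot>\<^sub>H (0, y - b, 0)"
      using that by (auto simp: p q \<pi>\<^sub>2_def heis_mult_def field_simps)
    then show ?thesis by blast
  qed
  then show ?thesis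
    by (auto simp: p \<pi>\<^sub>2_def heis_mult_def field_simps)
qed

text \<open>Two-dimensional Lebesgue outer measure on the planes \<open>{(0, y, t)}\<close> and \<open>{(x, 0, t)}\<close>,
  each identified with \<open>\<real>\<^sup>2\<close> by dropping the vanishing coordinate. These are only meant for
  subsets of the respective plane. Outer measure is used because the image of a
  Lebesgue measurable set under a vertical projection need not be measurable.\<close>

definition measure_yt :: "heis set \<Rightarrow> ennreal"
  where "measure_yt A = outer_measure_of lebesgue ((\<lambda>(x, y, t). (y, t)) ` A :: (real \<times> real) set)"

definition measure_xt :: "heis set \<Rightarrow> ennreal"
  where "measure_xt A = outer_measure_of lebesgue ((\<lambda>(x, y, t). (x, t)) ` A :: (real \<times> real) set)"

text \<open>Powers in \<open>[0, \<infinity>]\<close>, meant for exponents \<open>a > 0\<close> only: then \<open>0\<close> and \<open>\<infinity>\<close> are fixed.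
  The product on \<^typ>\<open>ennreal\<close> already obeys the convention \<open>0 \<cdot> \<infinity> = 0\<close>.\<close>

definition epowr :: "ennreal \<Rightarrow> real \<Rightarrow> ennreal"  (infixr "epowr" 80)
  where "u epowr a = (if u = \<infinity> then \<infinity> else ennreal (enn2real u powr a))"

end

theory Submission
  imports Defs
begin

text \<open>Let \<open>A\<close> and \<open>B\<close> be Borel hulls of the two projections and \<open>D (y, s)\<close> the measure of
  \<open>{x. (x, s - x * y) \<in> B}\<close>. By Tonelli, \<open>K\<close> has measure at most the integral of \<open>D\<close> over \<open>A\<close>,
  so it suffices to bound \<open>D\<close> in \<open>L\<^sup>3\<close>, that is, the X-ray transform of an indicator function.
  A set \<open>S\<close> of reals satisfies \<open>\<bar>S\<bar>\<^sup>2 \<le> 8 \<integral>\<^sub>S \<bar>x - x0\<bar> dx\<close>. Polar coordinates at \<open>(x0, u0)\<close>, in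
  which \<open>\<bar>x - x0\<bar>\<close> is the Jacobian, therefore show that \<open>D\<^sup>2\<close> integrated over the pencil of
  lines through \<open>(x0, u0)\<close> is at most \<open>8 \<bar>B\<bar>\<close>. Integrating over \<open>(x0, u0) \<in> B\<close> gives
  \<open>\<integral> D\<^sup>3 \<le> 8 \<bar>B\<bar>\<^sup>2\<close>, and Hoelder's inequality on \<open>A\<close> yields \<open>\<bar>K\<bar>\<^sup>3 \<le> 8 \<bar>A\<bar>\<^sup>2 \<bar>B\<bar>\<^sup>2\<close>.\<close>

section \<open>Tonelli and translation on the line and the plane\<close>

lemma nn_integral_lborel_Fubini:
  fixes f :: "real \<Rightarrow> real \<Rightarrow> ennreal"
  assumes "(\<lambda>p. f (fst p) (snd p)) \<in> borel_measurable (borel \<Otimes>\<^sub>M borel)"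
  shows "(\<integral>\<^sup>+x. \<integral>\<^sup>+y. f x y \<partial>lborel \<partial>lborel) = (\<integral>\<^sup>+y. \<integral>\<^sup>+x. f x y \<partial>lborel \<partial>lborel)"
proof -
  have "case_prod f \<in> borel_measurable (lborel \<Otimes>\<^sub>M lborel)"
    using assms by (simp add: case_prod_beta' cong: measurable_cong_sets)
  then show ?thesis
    by (rule lborel_pair.Fubini'[symmetric])
qed

lemma nn_integral_lborel_prod:
  fixes f :: "real \<times> real \<Rightarrow> ennreal"
  assumes "f \<in> borel_measurable borel"
  shows "(\<integral>\<^sup>+p. f p \<partial>lborel) = (\<integral>\<^sup>+x. \<integral>\<^sup>+y. f (x, y) \<partial>lborel \<partial>lborel)"
  using assms
  by (subst lborel_prod[symmetric], subst lborel.nn_integral_fst) (auto simp: lborel_prod)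

lemma nn_integral_lborel_translate:
  fixes f :: "real \<Rightarrow> ennreal"
  assumes "f \<in> borel_measurable borel"
  shows "(\<integral>\<^sup>+x. f (c + x) \<partial>lborel) = (\<integral>\<^sup>+x. f x \<partial>lborel)"
  using nn_integral_real_affine[OF assms, of 1 c] by simp

text \<open>On the part of \<open>S\<close> at distance at least \<open>r\<close> from
  \<open>x0\<close> the weight is at least \<open>r\<close>; the rest lies in an interval of length
  \<open>2 * r\<close>. Then \<open>r\<close> is optimised.\<close>

lemma square_emeasure_le_moment:
  fixes x0 :: real
  assumes S [measurable]: "S \<in> sets borel"
  shows "(emeasure lborel S)\<^sup>2 \<le> 8 * (\<integral>\<^sup>+x. ennreal \<bar>x - x0\<bar> * indicator S x \<partial>lborel)"
    (is "_ \<le> 8 * ?I")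
proof -
  have bound: "ennreal r * emeasure lborel S \<le> ?I + ennreal (2 * r\<^sup>2)" if "0 \<le> r" for r
  proof -
    have "ennreal r * emeasure lborel S = (\<integral>\<^sup>+x. ennreal r * indicator S x \<partial>lborel)"
      by (simp add: nn_integral_cmult_indicator)
    also have "\<dots> \<le> (\<integral>\<^sup>+x. ennreal \<bar>x - x0\<bar> * indicator S x
        + ennreal r * indicator {x0 - r..x0 + r} x \<partial>lborel)"
      using that by (intro nn_integral_mono) (auto simp: indicator_def intro!: ennreal_leI)
    also have "\<dots> = ?I + ennreal r * emeasure lborel {x0 - r..x0 + r}"
      by (subst nn_integral_add) (auto simp: nn_integral_cmult_indicator)
    also have "ennreal r * emeasure lborel {x0 - r..x0 + r} = ennreal (2 * r\<^sup>2)"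
      using that by (simp add: ennreal_mult[symmetric] power2_eq_square algebra_simps)
    finally show ?thesis .
  qed
  show ?thesis
  proof (cases "?I = \<infinity>")
    case False
    then obtain i where i: "0 \<le> i" "?I = ennreal i"
      by (cases ?I) auto
    \<comment> \<open>Finiteness comes first, so that \<open>r\<close> can next be a fraction of the
      measure.\<close>
    have "emeasure lborel S \<noteq> \<infinity>"
      using bound[of 1] i by (auto simp: top_unique simp flip: ennreal_plus)
    then obtain m where m: "0 \<le> m" "emeasure lborel S = ennreal m"
      by (cases "emeasure lborel S") auto
    \<comment> \<open>\<open>r = m / 4\<close> maximises \<open>r * m - 2 * r\<^sup>2\<close>; the
      maximum \<open>m\<^sup>2 / 8\<close> is the source of the constant 8.\<close>
    have "ennreal (m / 4 * m) \<le> ennreal (i + 2 * (m / 4)\<^sup>2)"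
      using bound[of "m / 4"] m i by (simp flip: ennreal_plus ennreal_mult)
    then have "m\<^sup>2 \<le> 8 * i"
      using m i by (simp add: power2_eq_square field_simps)
    then have "ennreal (m\<^sup>2) \<le> ennreal (8 * i)"
      by (rule ennreal_leI)
    then show ?thesis
      using m i by (simp add: ennreal_mult flip: ennreal_power)
  qed simp
qed

section \<open>Lengths of lines in a planar set\<close>

text \<open>The fibre of \<open>\<pi>\<^sub>1\<close> over \<open>(0, y, s)\<close> consists of the points \<open>(x, y, s - x * y / 2)\<close>, which
  \<open>\<pi>\<^sub>2\<close> maps to \<open>(x, 0, s - x * y)\<close>; \<open>line_length B (y, s)\<close> is the length of the part mapped into \<open>B\<close>.\<close>

definition line_length :: "(real \<times> real) set \<Rightarrow> real \<times> real \<Rightarrow> ennreal"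
  where "line_length B p = (\<integral>\<^sup>+x. indicator B (x, snd p - x * fst p) \<partial>lborel)"

lemma borel_measurable_line_length [measurable]:
  assumes [measurable]: "B \<in> sets borel"
  shows "line_length B \<in> borel_measurable borel"
proof -
  have "(\<lambda>p. \<integral>\<^sup>+x. indicator B (x, snd p - x * fst p) \<partial>lborel)
      \<in> borel_measurable (borel \<Otimes>\<^sub>M borel :: (real \<times> real) measure)"
    by measurable
  then show ?thesis
    by (simp add: line_length_def[abs_def] borel_prod)
qed

lemma line_length_square_le_moment:
  assumes [measurable]: "B \<in> sets borel"
  shows "(line_length B (y, s))\<^sup>2
    \<le> 8 * (\<integral>\<^sup>+x. ennreal \<bar>x - x0\<bar> * indicator B (x, s - x * y) \<partial>lborel)"
proof -
  let ?S = "{x. (x, s - x * y) \<in> B}"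
  have [measurable]: "?S \<in> sets borel"
    by measurable
  have ind: "indicator B (x, s - x * y) = (indicator ?S x :: ennreal)" for x
    by (simp add: indicator_def)
  show ?thesis
    unfolding line_length_def fst_conv snd_conv ind nn_integral_indicator[of ?S lborel, simplified]
    using square_emeasure_le_moment[of ?S x0] by simp
qed

text \<open>The lines through \<open>(x0, u0)\<close> sweep out the plane with Jacobian \<open>\<bar>x - x0\<bar>\<close>.\<close>

lemma nn_integral_line_length_square_pencil:
  assumes [measurable]: "B \<in> sets borel"
  shows "(\<integral>\<^sup>+y. (line_length B (y, u0 + x0 * y))\<^sup>2 \<partial>lborel) \<le> 8 * emeasure lborel B"
proof -
  \<comment> \<open>For fixed \<open>x\<close>, the substitution
    \<open>u = u0 + (x0 - x) * y\<close> absorbs the weight. It degenerates only at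
    \<open>x = x0\<close>, a null set.\<close>
  have sweep: "(\<integral>\<^sup>+y. ennreal \<bar>x - x0\<bar> * indicator B (x, u0 + x0 * y - x * y) \<partial>lborel)
      = (\<integral>\<^sup>+u. indicator B (x, u) \<partial>lborel)" if "x \<noteq> x0" for x
    using nn_integral_real_affine[of "\<lambda>u. indicator B (x, u)" "x0 - x" u0] that
    by (simp add: nn_integral_cmult abs_minus_commute algebra_simps)
  have "(\<integral>\<^sup>+y. (line_length B (y, u0 + x0 * y))\<^sup>2 \<partial>lborel)
      \<le> (\<integral>\<^sup>+y. 8 * (\<integral>\<^sup>+x. ennreal \<bar>x - x0\<bar> * indicator B (x, u0 + x0 * y - x * y) \<partial>lborel) \<partial>lborel)"
    by (intro nn_integral_mono line_length_square_le_moment) measurable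
  also have "\<dots> = 8 * (\<integral>\<^sup>+y. \<integral>\<^sup>+x. ennreal \<bar>x - x0\<bar> * indicator B (x, u0 + x0 * y - x * y) \<partial>lborel \<partial>lborel)"
    by (subst nn_integral_cmult) auto
  also have "(\<integral>\<^sup>+y. \<integral>\<^sup>+x. ennreal \<bar>x - x0\<bar> * indicator B (x, u0 + x0 * y - x * y) \<partial>lborel \<partial>lborel)
      = (\<integral>\<^sup>+x. \<integral>\<^sup>+y. ennreal \<bar>x - x0\<bar> * indicator B (x, u0 + x0 * y - x * y) \<partial>lborel \<partial>lborel)"
    by (rule nn_integral_lborel_Fubini) measurable
  also have "\<dots> = (\<integral>\<^sup>+x. \<integral>\<^sup>+u. indicator B (x, u) \<partial>lborel \<partial>lborel)"
    using AE_lborel_singleton[of x0] by (intro nn_integral_cong_AE) (auto simp: sweep)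
  also have "\<dots> = emeasure lborel B"
    by (subst nn_integral_lborel_prod[symmetric]) auto
  finally show ?thesis .
qed

text \<open>One of the three factors is expanded as an integral over the points of the line in
  \<open>B\<close>. After exchanging integrals, each point of \<open>B\<close> carries the squared
  lengths over its pencil of lines.\<close>

lemma nn_integral_line_length_cube:
  assumes [measurable]: "B \<in> sets borel"
  shows "(\<integral>\<^sup>+p. (line_length B p) ^ 3 \<partial>lborel) \<le> 8 * (emeasure lborel B)\<^sup>2"
proof -
  let ?L = "line_length B"
  have "(\<integral>\<^sup>+p. ?L p ^ 3 \<partial>lborel) = (\<integral>\<^sup>+y. \<integral>\<^sup>+s. ?L (y, s) ^ 3 \<partial>lborel \<partial>lborel)"
    by (rule nn_integral_lborel_prod) measurable
  also have "\<dots> = (\<integral>\<^sup>+y. \<integral>\<^sup>+s. \<integral>\<^sup>+x. (?L (y, s))\<^sup>2 * indicator B (x, s - x * y) \<partial>lborel \<partial>lborel \<partial>lborel)"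
    by (subst nn_integral_cmult) (auto simp: line_length_def power3_eq_cube power2_eq_square)
  also have "\<dots> = (\<integral>\<^sup>+y. \<integral>\<^sup>+x. \<integral>\<^sup>+s. (?L (y, s))\<^sup>2 * indicator B (x, s - x * y) \<partial>lborel \<partial>lborel \<partial>lborel)"
    by (rule nn_integral_cong, rule nn_integral_lborel_Fubini) measurable
  \<comment> \<open>With \<open>s = u + x * y\<close>, varying \<open>y\<close> at fixed
    \<open>(x, u)\<close> runs through the nonvertical lines through that point.\<close>
  also have "\<dots> = (\<integral>\<^sup>+y. \<integral>\<^sup>+x. \<integral>\<^sup>+u. (?L (y, u + x * y))\<^sup>2 * indicator B (x, u) \<partial>lborel \<partial>lborel \<partial>lborel)"
  proof (rule nn_integral_cong, rule nn_integral_cong)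
    fix y x :: real
    show "(\<integral>\<^sup>+s. (?L (y, s))\<^sup>2 * indicator B (x, s - x * y) \<partial>lborel)
        = (\<integral>\<^sup>+u. (?L (y, u + x * y))\<^sup>2 * indicator B (x, u) \<partial>lborel)"
      by (subst nn_integral_lborel_translate[of _ "x * y", symmetric]) (auto simp: add.commute)
  qed
  also have "\<dots> = (\<integral>\<^sup>+x. \<integral>\<^sup>+y. \<integral>\<^sup>+u. (?L (y, u + x * y))\<^sup>2 * indicator B (x, u) \<partial>lborel \<partial>lborel \<partial>lborel)"
    by (rule nn_integral_lborel_Fubini) measurable
  also have "\<dots> = (\<integral>\<^sup>+x. \<integral>\<^sup>+u. \<integral>\<^sup>+y. (?L (y, u + x * y))\<^sup>2 * indicator B (x, u) \<partial>lborel \<partial>lborel \<partial>lborel)"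
    by (rule nn_integral_cong, rule nn_integral_lborel_Fubini) measurable
  also have "\<dots> \<le> (\<integral>\<^sup>+x. \<integral>\<^sup>+u. 8 * emeasure lborel B * indicator B (x, u) \<partial>lborel \<partial>lborel)"
    by (intro nn_integral_mono)
      (auto simp: nn_integral_multc intro!: mult_right_mono nn_integral_line_length_square_pencil)
  also have "\<dots> = (\<integral>\<^sup>+p. 8 * emeasure lborel B * indicator B p \<partial>lborel)"
    by (subst nn_integral_lborel_prod) auto
  also have "\<dots> = 8 * (emeasure lborel B)\<^sup>2"
    by (subst nn_integral_cmult_indicator) (auto simp: power2_eq_square mult.assoc)
  finally show ?thesis .
qed

text \<open>Tangent line inequality for the cube, which replaces Hoelder's inequality below.\<close>

lemma cube_tangent_ennreal:
  fixes d :: ennreal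
  assumes "0 \<le> r"
  shows "ennreal (3 * r\<^sup>2) * d \<le> d ^ 3 + ennreal (2 * r ^ 3)"
proof (cases d)
  case (real x)
  \<comment> \<open>This product expands to
    \<open>x ^ 3 - 3 * r\<^sup>2 * x + 2 * r ^ 3\<close>.\<close>
  have "0 \<le> (x - r)\<^sup>2 * (x + 2 * r)"
    using assms real by simp
  then have "3 * r\<^sup>2 * x \<le> x ^ 3 + 2 * r ^ 3"
    by (simp add: power2_eq_square power3_eq_cube algebra_simps)
  then show ?thesis
    using assms real by (auto simp: ennreal_power simp flip: ennreal_mult ennreal_plus intro!: ennreal_leI)
qed (simp add: power3_eq_cube)

text \<open>The tangent inequality is integrated over \<open>A\<close>; the tangent point
  \<open>r\<close> stays free for later optimisation.\<close>

lemma nn_integral_indicator_line_length_le: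
  assumes [measurable]: "A \<in> sets borel" "B \<in> sets borel" and r: "0 \<le> r"
  shows "ennreal (3 * r\<^sup>2) * (\<integral>\<^sup>+p. indicator A p * line_length B p \<partial>lborel)
    \<le> 8 * (emeasure lborel B)\<^sup>2 + ennreal (2 * r ^ 3) * emeasure lborel A"
proof -
  have "ennreal (3 * r\<^sup>2) * (\<integral>\<^sup>+p. indicator A p * line_length B p \<partial>lborel)
      = (\<integral>\<^sup>+p. ennreal (3 * r\<^sup>2) * (indicator A p * line_length B p) \<partial>lborel)"
    by (subst nn_integral_cmult) auto
  also have "\<dots> \<le> (\<integral>\<^sup>+p. line_length B p ^ 3 + ennreal (2 * r ^ 3) * indicator A p \<partial>lborel)"
    using cube_tangent_ennreal[OF r] by (intro nn_integral_mono) (auto simp: indicator_def)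
  also have "\<dots> = (\<integral>\<^sup>+p. line_length B p ^ 3 \<partial>lborel) + ennreal (2 * r ^ 3) * emeasure lborel A"
    by (subst nn_integral_add) (auto simp: nn_integral_cmult_indicator)
  also have "\<dots> \<le> 8 * (emeasure lborel B)\<^sup>2 + ennreal (2 * r ^ 3) * emeasure lborel A"
    by (intro add_right_mono nn_integral_line_length_cube) measurable
  finally show ?thesis .
qed

text \<open>Covers the convention that zero times infinity is zero: the other set may have infinite
  measure. For null \<open>B\<close> the cube bound forces \<open>line_length B\<close> to vanish
  almost everywhere.\<close>

lemma nn_integral_indicator_line_length_eq_0:
  assumes [measurable]: "A \<in> sets borel" "B \<in> sets borel"
    and "emeasure lborel A = 0 \<or> emeasure lborel B = 0"
  shows "(\<integral>\<^sup>+p. indicator A p * line_length B p \<partial>lborel) = 0"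
  using assms(3)
proof
  assume "emeasure lborel A = 0"
  then have "AE p in lborel. p \<notin> A"
    by (intro AE_not_in) auto
  then show ?thesis
    by (subst nn_integral_0_iff_AE) (auto elim!: eventually_mono)
next
  assume "emeasure lborel B = 0"
  then have "(\<integral>\<^sup>+p. (line_length B p) ^ 3 \<partial>lborel) = 0"
    using nn_integral_line_length_cube[of B] by simp
  then have "AE p in lborel. line_length B p ^ 3 = 0"
    by (subst (asm) nn_integral_0_iff_AE) auto
  then show ?thesis
    by (subst nn_integral_0_iff_AE) (auto elim!: eventually_mono)
qed

lemma nn_integral_indicator_line_length_cube_le:
  assumes [measurable]: "A \<in> sets borel" "B \<in> sets borel"
    and a: "emeasure lborel A = ennreal a" "0 \<le> a" and b: "emeasure lborel B = ennreal b" "0 \<le> b"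
  obtains k where "0 \<le> k" "(\<integral>\<^sup>+p. indicator A p * line_length B p \<partial>lborel) = ennreal k"
    "k ^ 3 \<le> 8 * a\<^sup>2 * b\<^sup>2"
proof -
  let ?K = "\<integral>\<^sup>+p. indicator A p * line_length B p \<partial>lborel"
  have le: "ennreal (3 * r\<^sup>2) * ?K \<le> ennreal (8 * b\<^sup>2 + 2 * r ^ 3 * a)" if "0 \<le> r" for r
    using nn_integral_indicator_line_length_le[of A B r] that a b
    by (simp add: ennreal_power ennreal_mult)
  have "?K \<noteq> \<infinity>"
    using le[of 1] by (auto simp: ennreal_mult_top top_unique)
  then obtain k where k: "0 \<le> k" "?K = ennreal k"
    by (cases ?K) auto
  have "k ^ 3 \<le> 8 * a\<^sup>2 * b\<^sup>2"
  proof (cases "a = 0")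
    case True
    then have "k = 0"
      using nn_integral_indicator_line_length_eq_0[of A B] a k by simp
    then show ?thesis
      by (simp add: True)
  next
    case False
    \<comment> \<open>The optimal tangent point is \<open>k / a\<close>, the mean of
      \<open>line_length B\<close> over \<open>A\<close>.\<close>
    have "3 * (k / a)\<^sup>2 * k \<le> 8 * b\<^sup>2 + 2 * (k / a) ^ 3 * a"
      using le[of "k / a"] k a
      by (subst ennreal_le_iff[symmetric]) (simp_all add: ennreal_mult del: ennreal_plus)
    also have "2 * (k / a) ^ 3 * a = 2 * (k / a)\<^sup>2 * k"
      using False by (simp add: power2_eq_square power3_eq_cube)
    finally have "(k / a)\<^sup>2 * k \<le> 8 * b\<^sup>2"
      by linarith
    then have "(k / a)\<^sup>2 * k * a\<^sup>2 \<le> 8 * b\<^sup>2 * a\<^sup>2"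
      by (intro mult_right_mono) auto
    then show ?thesis
      using False by (simp add: power2_eq_square power3_eq_cube field_simps)
  qed
  with k show ?thesis
    by (rule that)
qed

section \<open>From the Heisenberg group to the plane\<close>

text \<open>\<open>W\<close> is the largest set whose projections lie in \<open>A\<close> and
  \<open>B\<close>.\<close>

lemma emeasure_cylinder_Int:
  assumes [measurable]: "A \<in> sets borel" "B \<in> sets borel"
  defines "W \<equiv> {(x, y, t). (y, t + x * y / 2) \<in> A \<and> (x, t - x * y / 2) \<in> B}"
  shows "W \<in> sets borel"
    and "emeasure lborel W = (\<integral>\<^sup>+p. indicator A p * line_length B p \<partial>lborel)"
proof -
  let ?f = "\<lambda>x y t. indicator A (y, t + x * y / 2) * indicator B (x, t - x * y / 2) :: ennreal"
  have ind: "indicator W (x, y, t) = ?f x y t" for x y t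
    by (simp add: W_def indicator_def)
  let ?M = "borel \<Otimes>\<^sub>M (borel \<Otimes>\<^sub>M borel) :: (real \<times> real \<times> real) measure"
  have "W = {p \<in> space ?M. (fst (snd p), snd (snd p) + fst p * fst (snd p) / 2) \<in> A
      \<and> (fst p, snd (snd p) - fst p * fst (snd p) / 2) \<in> B}"
    by (auto simp: W_def space_pair_measure)
  also have "\<dots> \<in> sets ?M"
    by measurable
  finally show W [measurable]: "W \<in> sets borel"
    unfolding borel_prod .
  have "emeasure lborel W = (\<integral>\<^sup>+p. indicator W p \<partial>(lborel \<Otimes>\<^sub>M lborel))"
    by (simp add: lborel_prod)
  also have "\<dots> = (\<integral>\<^sup>+x. \<integral>\<^sup>+q. indicator W (x, q) \<partial>lborel \<partial>lborel)"
    by (subst lborel.nn_integral_fst) (auto simp: lborel_prod)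
  also have "\<dots> = (\<integral>\<^sup>+x. \<integral>\<^sup>+y. \<integral>\<^sup>+t. ?f x y t \<partial>lborel \<partial>lborel \<partial>lborel)"
    by (subst nn_integral_lborel_prod) (auto simp: ind)
  \<comment> \<open>The shear \<open>s = t + x * y / 2\<close> frees the first indicator from
    \<open>x\<close>, so the \<open>x\<close>-integral falls on \<open>B\<close> alone.\<close>
  also have "\<dots> = (\<integral>\<^sup>+x. \<integral>\<^sup>+y. \<integral>\<^sup>+s. indicator A (y, s) * indicator B (x, s - x * y) \<partial>lborel \<partial>lborel \<partial>lborel)"
  proof (rule nn_integral_cong, rule nn_integral_cong)
    fix x y :: real
    show "(\<integral>\<^sup>+t. ?f x y t \<partial>lborel) = (\<integral>\<^sup>+s. indicator A (y, s) * indicator B (x, s - x * y) \<partial>lborel)"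
      by (subst nn_integral_lborel_translate[of _ "x * y / 2", symmetric]) (auto simp: algebra_simps)
  qed
  also have "\<dots> = (\<integral>\<^sup>+y. \<integral>\<^sup>+x. \<integral>\<^sup>+s. indicator A (y, s) * indicator B (x, s - x * y) \<partial>lborel \<partial>lborel \<partial>lborel)"
    by (rule nn_integral_lborel_Fubini) measurable
  also have "\<dots> = (\<integral>\<^sup>+y. \<integral>\<^sup>+s. \<integral>\<^sup>+x. indicator A (y, s) * indicator B (x, s - x * y) \<partial>lborel \<partial>lborel \<partial>lborel)"
    by (rule nn_integral_cong, rule nn_integral_lborel_Fubini) measurable
  also have "\<dots> = (\<integral>\<^sup>+y. \<integral>\<^sup>+s. indicator A (y, s) * line_length B (y, s) \<partial>lborel \<partial>lborel)"
    by (simp add: nn_integral_cmult line_length_def)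
  also have "\<dots> = (\<integral>\<^sup>+p. indicator A p * line_length B p \<partial>lborel)"
    by (rule nn_integral_lborel_prod[symmetric]) measurable
  finally show "emeasure lborel W = (\<integral>\<^sup>+p. indicator A p * line_length B p \<partial>lborel)" .
qed

text \<open>Replaces possibly nonmeasurable projections by Borel sets of the same outer measure, to
  which Tonelli applies.\<close>

lemma outer_measure_of_lebesgue_attain:
  fixes S :: "'a::euclidean_space set"
  obtains E where "E \<in> sets borel" "S \<subseteq> E" "outer_measure_of lebesgue S = emeasure lborel E"
proof -
  obtain F where F: "F \<in> sets lebesgue" "S \<subseteq> F" "outer_measure_of lebesgue S = emeasure lebesgue F"
    using outer_measure_of_attain[of S lebesgue] by auto
  obtain E where "F \<subseteq> E" "E \<in> sets lborel" "emeasure lebesgue F = emeasure lborel E"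
    using F(1) by (rule completion_upper)
  with F show ?thesis
    by (intro that[of E]) auto
qed

lemma epowr_eq_0_iff [simp]: "u epowr a = 0 \<longleftrightarrow> u = 0"
  by (auto simp: epowr_def enn2real_eq_0_iff)

lemma epowr_ennreal: "0 \<le> x \<Longrightarrow> ennreal x epowr a = ennreal (x powr a)"
  by (simp add: epowr_def)

theorem theorem1p3:
  shows "\<exists>C::real. C \<ge> 1 \<and>
    (\<forall>K :: (real \<times> real \<times> real) set. K \<in> sets lebesgue \<longrightarrow>
      emeasure lebesgue K
        \<le> ennreal C * (measure_yt (\<pi>\<^sub>1 ` K) epowr (2/3)) * (measure_xt (\<pi>\<^sub>2 ` K) epowr (2/3)))"
\<comment> \<open>The witness 2 is the cube root of 8 in
  \<open>k ^ 3 \<le> 8 * a\<^sup>2 * b\<^sup>2\<close>.\<close>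
proof (intro exI[of _ 2] conjI allI impI)
  fix K :: "(real \<times> real \<times> real) set"
  assume K: "K \<in> sets lebesgue"
  obtain A where A: "A \<in> sets borel" "(\<lambda>(x, y, t). (y, t)) ` \<pi>\<^sub>1 ` K \<subseteq> A"
      "measure_yt (\<pi>\<^sub>1 ` K) = emeasure lborel A"
    unfolding measure_yt_def by (rule outer_measure_of_lebesgue_attain)
  obtain B where B: "B \<in> sets borel" "(\<lambda>(x, y, t). (x, t)) ` \<pi>\<^sub>2 ` K \<subseteq> B"
      "measure_xt (\<pi>\<^sub>2 ` K) = emeasure lborel B"
    unfolding measure_xt_def by (rule outer_measure_of_lebesgue_attain)
  define W where "W = {(x, y, t). (y, t + x * y / 2) \<in> A \<and> (x, t - x * y / 2) \<in> B}"
  let ?I = "\<integral>\<^sup>+p. indicator A p * line_length B p \<partial>lborel"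
  have W: "W \<in> sets borel" "emeasure lborel W = ?I"
    unfolding W_def using emeasure_cylinder_Int[OF A(1) B(1)] by auto
  have "K \<subseteq> W"
    using A(2) B(2) by (fastforce simp: W_def \<pi>\<^sub>1_def \<pi>\<^sub>2_def)
  then have "emeasure lebesgue K \<le> emeasure lebesgue W"
    using W(1) by (intro emeasure_mono) auto
  also have "\<dots> = ?I"
    using W by simp
  also have "?I \<le> ennreal 2 * (emeasure lborel A epowr (2/3)) * (emeasure lborel B epowr (2/3))"
  proof (cases "emeasure lborel A = 0 \<or> emeasure lborel B = 0")
    case True
    then show ?thesis
      using nn_integral_indicator_line_length_eq_0[OF A(1) B(1)] by simp
  next
    case nonzero: False
    show ?thesis
    \<comment> \<open>Since neither measure is zero, an infinite one makes the right-hand side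
      infinite.\<close>
    proof (cases "emeasure lborel A = \<infinity> \<or> emeasure lborel B = \<infinity>")
      case True
      then have "emeasure lborel A epowr (2/3) = \<infinity> \<or> emeasure lborel B epowr (2/3) = \<infinity>"
        by (auto simp: epowr_def)
      then have "ennreal 2 * (emeasure lborel A epowr (2/3)) * (emeasure lborel B epowr (2/3)) = \<infinity>"
        using nonzero by (auto simp: ennreal_mult_eq_top_iff)
      then show ?thesis
        by simp
    next
      case False
      then obtain a b where a: "emeasure lborel A = ennreal a" "0 \<le> a"
          and b: "emeasure lborel B = ennreal b" "0 \<le> b"
        by (cases "emeasure lborel A"; cases "emeasure lborel B") auto
      obtain k where k: "0 \<le> k" "?I = ennreal k" "k ^ 3 \<le> 8 * a\<^sup>2 * b\<^sup>2"
        using nn_integral_indicator_line_length_cube_le[OF A(1) B(1) a b] .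
      have cube: "(x powr (2/3)) ^ 3 = x\<^sup>2" if "0 \<le> x" for x :: real
        using that by (cases "x = 0") (auto simp: powr_power)
      have "k ^ 3 \<le> (2 * a powr (2/3) * b powr (2/3)) ^ 3"
        using k(3) a b by (simp add: power_mult_distrib cube)
      then have "k \<le> 2 * a powr (2/3) * b powr (2/3)"
        by (rule power_le_imp_le_base[of _ 2, simplified]) auto
      then have "ennreal k \<le> ennreal (2 * a powr (2/3) * b powr (2/3))"
        by (rule ennreal_leI)
      then show ?thesis
        using k a b by (simp add: epowr_ennreal ennreal_mult)
    qed
  qed
  finally show "emeasure lebesgue K
      \<le> ennreal 2 * (measure_yt (\<pi>\<^sub>1 ` K) epowr (2/3)) * (measure_xt (\<pi>\<^sub>2 ` K) epowr (2/3))"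
    by (simp only: A(3) B(3))
qed simp

end
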